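(* Let $p\ge 11$ be a prime, $a\in\mathbb F_p^*$ and $c\in\mathbb F_p$. The function $\mathcal B_{a,c,p}$ is an APN permutation of $\mathbb Z_{2p}$ if and only if $$\chi(a)=\chi(-3)=\chi(1-4a)=\chi(1-4/a)=-1.$$ In particular, whether $\mathcal B_{a,c,p}$ is an APN permutation does not depend on $c$.
   Context: $\mathbb Z_n=\mathbb Z/n\mathbb Z$. The differential uniformity of $F:\mathbb Z_n\to\mathbb Z_n$ is $\delta(F)=\max_{u\neq 0,\,v\in\mathbb Z_n}\#\{x\in\mathbb Z_n: F(x+u)-F(x)=v\}$, and $F$ is called APN if $\delta(F)=2$. Let $p\ge 11$ be a prime, $a\in\mathbb F_p^*$, $c\in\mathbb F_p$. $\chi$ is the quadratic character of $\mathbb F_p$ (with $\chi(0)=0$), and $\rho(x)=1$ if $\chi(x)=1$, $\rho(x)=0$ otherwise (so $\rho(0)=0$). For $z\in\mathbb Z_{2p}$ let $E(z)=(1-(-1)^z)/2\in\{0,1\}$ (the parity of $z$) and let $X_c(z)\in\mathbb F_p$ be the residue class of $z+cE(z)$ modulo $p$. In $\mathbb F_p$ set $A_a(z)=1+(a-1)E(z)$ and $Y_{a,c,p}(z)=A_a(z)X_c(z)^{p-2}$. Let $R_{c,p}(z)\in\{0,1\}$ be congruent modulo $2$ to $\rho(X_c(z))+E(z)\bigl(1-\chi(X_c(z))^2\bigr)$. Define $\mathcal B_{a,c,p}:\mathbb Z_{2p}\to\mathbb Z_{2p}$ by $$\mathcal B_{a,c,p}(z)\equiv pR_{c,p}(z)+(p+1)Y_{a,c,p}(z)\pmod{2p},$$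 where $Y_{a,c,p}(z)$ is replaced by any integer representative (the result is independent of the choice since $2p\mid p(p+1)$). *)

theory Defs
  imports "HOL-Number_Theory.Number_Theory" "HOL-Library.Cardinality"
begin

text \<open>
  The ring \<open>\<int>/n\<int>\<close> is represented by the residues \<open>{0..<int n}\<close>, and a function
  on it by a function on \<^typ>\<open>int\<close> of which only the values on \<open>{0..<int n}\<close>, modulo \<open>n\<close>,
  matter.
\<close>

definition differential_uniformity :: "nat \<Rightarrow> (int \<Rightarrow> int) \<Rightarrow> nat" where
  "differential_uniformity n F =
     Max {card {x \<in> {0..<int n}. [F ((x + u) mod int n) - F x = v] (mod int n)} | u v.
            u \<in> {0..<int n} - {0} \<and> v \<in> {0..<int n}}"

definition APN :: "nat \<Rightarrow> (int \<Rightarrow> int) \<Rightarrow> bool" where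
  "APN n F \<longleftrightarrow> differential_uniformity n F = 2"

definition APN_permutation :: "nat \<Rightarrow> (int \<Rightarrow> int) \<Rightarrow> bool" where
  "APN_permutation n F \<longleftrightarrow> bij_betw F {0..<int n} {0..<int n} \<and> APN n F"

text \<open>
  The prime field \<open>\<bbbF>\<^sub>p\<close> is a type \<open>'k\<close> of classes \<open>field\<close> and \<open>finite\<close> with
  \<open>CARD('k) = p\<close>, \<open>p\<close> prime. The residue class modulo \<open>p\<close> of an integer \<open>z\<close> is
  then \<open>of_int z :: 'k\<close>.
\<close>

definition quad_char :: "'k::field \<Rightarrow> int" where
  "quad_char x = (if x = 0 then 0 else if \<exists>y. y ^ 2 = x then 1 else - 1)"

definition rho :: "'k::field \<Rightarrow> int" where
  "rho x = (if quad_char x = 1 then 1 else 0)"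

definition bitE :: "int \<Rightarrow> int" where
  "bitE z = z mod 2"

definition Xc :: "'k::field \<Rightarrow> int \<Rightarrow> 'k" where
  "Xc c z = of_int z + c * of_int (bitE z)"

definition Aa :: "'k::field \<Rightarrow> int \<Rightarrow> 'k" where
  "Aa a z = 1 + (a - 1) * of_int (bitE z)"

definition Yac :: "nat \<Rightarrow> 'k::field \<Rightarrow> 'k \<Rightarrow> int \<Rightarrow> 'k" where
  "Yac p a c z = Aa a z * Xc c z ^ (p - 2)"

definition Rc :: "'k::field \<Rightarrow> int \<Rightarrow> int" where
  "Rc c z = (rho (Xc c z) + bitE z * (1 - quad_char (Xc c z) ^ 2)) mod 2"

definition residue :: "nat \<Rightarrow> 'k::field \<Rightarrow> int" where
  "residue p x = (THE k. k \<in> {0..<int p} \<and> of_int k = x)"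

definition Bac :: "nat \<Rightarrow> 'k::field \<Rightarrow> 'k \<Rightarrow> int \<Rightarrow> int" where
  "Bac p a c z = (int p * Rc c z + (int p + 1) * residue p (Yac p a c z)) mod (2 * int p)"


lemma CHAR_prime_card:
  assumes "prime p" and "card (UNIV :: 'k::{field,finite} set) = p"
  shows "CHAR('k) = p"
  using assms CHAR_dvd_CARD[where ?'a = 'k] CHAR_not_1[where ?'a = 'k]
  by (auto simp: prime_nat_iff)

lemma of_int_bij_betw_prime_field:
  assumes "prime p" and "card (UNIV :: 'k::{field,finite} set) = p"
  shows "bij_betw (of_int :: int \<Rightarrow> 'k) {0..<int p} UNIV"
proof -
  have inj: "inj_on (of_int :: int \<Rightarrow> 'k) {0..<int p}"
    by (rule inj_onI)
      (auto simp: of_int_eq_iff_cong_CHAR CHAR_prime_card[OF assms] cong_def)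
  moreover have "of_int ` {0..<int p} = (UNIV :: 'k set)"
    by (rule card_subset_eq) (use assms inj in \<open>auto simp: card_image\<close>)
  ultimately show ?thesis
    by (simp add: bij_betw_def)
qed

lemma residue:
  fixes x :: "'k::{field,finite}"
  assumes "prime p" and "CARD('k) = p"
  shows "residue p x \<in> {0..<int p}" and "of_int (residue p x) = x"
proof -
  have "\<exists>!k. k \<in> {0..<int p} \<and> of_int k = x"
    using of_int_bij_betw_prime_field[OF assms] unfolding bij_betw_def inj_on_def
    by (metis UNIV_I imageE)
  from theI'[OF this] show "residue p x \<in> {0..<int p}" "of_int (residue p x) = x"
    unfolding residue_def by auto
qed

text \<open>Any integer representative of \<open>Yac p a c z\<close> may be used in place of its residue.\<close>

lemma Bac_eq:
  fixes a c :: "'k::{field,finite}"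
  assumes "prime p" and "odd p" and "CARD('k) = p" and y: "of_int y = Yac p a c z"
  shows "Bac p a c z = (int p * Rc c z + (int p + 1) * y) mod (2 * int p)"
proof -
  have "(of_int (residue p (Yac p a c z)) :: 'k) = of_int y"
    using residue(2)[OF assms(1,3)] y by metis
  hence "[residue p (Yac p a c z) = y] (mod int p)"
    by (simp add: of_int_eq_iff_cong_CHAR CHAR_prime_card[OF assms(1,3)])
  hence "int p dvd residue p (Yac p a c z) - y"
    by (simp add: cong_iff_dvd_diff)
  moreover have "2 dvd int p + 1"
    using \<open>odd p\<close> by simp
  ultimately have "2 * int p dvd (int p + 1) * (residue p (Yac p a c z) - y)"
    by (rule mult_dvd_mono[rotated])
  hence "[int p * Rc c z + (int p + 1) * residue p (Yac p a c z) =
      int p * Rc c z + (int p + 1) * y] (mod (2 * int p))"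
    by (simp add: cong_iff_dvd_diff algebra_simps)
  thus ?thesis
    by (simp add: Bac_def cong_def)
qed

end

theory Submission
  imports Defs
begin

text \<open>
  By the Chinese remainder theorem, \<open>z \<mapsto> (z mod 2, X\<^sub>c(z))\<close> identifies \<open>\<int>/2p\<close> with two copies
  (layers) of the field \<open>\<bbbF>\<^sub>p\<close>. Read in these coordinates, the function is \<open>x \<mapsto> 1/x\<close> on
  the even layer and \<open>x \<mapsto> a/x\<close> on the odd one, decorated with a parity bit that records whether
  \<open>x\<close> is a square and that separates the two zeros. Since \<open>y \<noteq> 0\<close> is hit from \<open>1/y\<close> and from
  \<open>a/y\<close>, with the bits given by \<open>\<chi>(y)\<close> and \<open>\<chi>(a) \<chi>(y)\<close>, the function is a permutation exactly
  when \<open>\<chi>(a) = -1\<close> (\<open>bij_Bac_iff\<close>). For a permutation, some difference is always attained at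
  least twice, so APN means that no difference is attained three times (\<open>permutation_APN_iff\<close>).

  Suppose that \<open>\<chi>(a) = -1\<close> and write \<open>m\<close> for the numerator of a layer, \<open>1\<close> or \<open>a\<close>.

  An even shift moves \<open>x\<close> to \<open>x + w\<close>, with \<open>w \<noteq> 0\<close>, within each layer. If neither \<open>x\<close> nor
  \<open>x + w\<close> is \<open>0\<close>, then \<open>m/(x + w) - m/x = b\<close> says \<open>b x (x + w) = - m w\<close>: a quadratic
  equation, and the change of the bit, which is governed by \<open>\<chi>(x (x + w)) = \<chi>(- m w b)\<close>, does not
  depend on the root. As the two values of \<open>m\<close> differ by the nonsquare \<open>a\<close>, the two layers show
  opposite changes of the bit, so these ordinary solutions number at most two. The exceptional
  solutions \<open>x = 0\<close> and \<open>x = - w\<close> occur only for \<open>b w = m\<close>. For that \<open>b\<close> the ordinary equation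
  of the layer with numerator \<open>m'\<close> has discriminant \<open>1 - 4 m'/m\<close> up to a square, which is
  \<open>-3\<close>, \<open>1 - 4 a\<close> or \<open>1 - 4/a\<close>. If these three are nonsquares, exceptional and ordinary
  solutions exclude each other (\<open>card_solutions_even_le\<close>). If one of them is a nonzero square, two
  ordinary solutions exist, and choosing \<open>w\<close> to be a square or a nonsquare gives the exceptional
  solution \<open>x = 0\<close> the same change of the bit: a difference attained three times
  (\<open>three_solutions\<close>). None of the three is zero: \<open>p > 3\<close>, and \<open>a\<close> is neither \<open>1/4\<close>
  nor \<open>4\<close>, which are squares.

  An odd shift exchanges the layers. Under the same conditions each layer then contributes at most
  one solution (\<open>cross_unique\<close>): the discriminants again keep exceptional and ordinary solutions
  apart, and for ordinary ones Vieta's formulas show that \<open>x (x + k)\<close> at the two roots of the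
  quadratic equation multiply to \<open>a\<close> times a square, so the roots show opposite changes of the bit.
  Hence odd shifts impose no further condition. The parameter \<open>c\<close> enters only through
  the amount by which an odd shift moves \<open>x\<close>, which is arbitrary anyway.
\<close>

section \<open>APN permutations\<close>

definition derivative_fibre :: "nat \<Rightarrow> (int \<Rightarrow> int) \<Rightarrow> int \<Rightarrow> int \<Rightarrow> int set" where
  "derivative_fibre n F u v = {x \<in> {0..<int n}. [F ((x + u) mod int n) - F x = v] (mod int n)}"

lemma finite_derivative_fibre [simp]: "finite (derivative_fibre n F u v)"
  unfolding derivative_fibre_def by (rule finite_subset[of _ "{0..<int n}"]) auto

text \<open>
  The differential uniformity of a permutation cannot be below \<open>2\<close>: the difference function
  for the shift \<open>1\<close> omits the value \<open>0\<close>, so by pigeonhole it takes some value twice.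
\<close>

lemma permutation_APN_iff:
  assumes n: "2 \<le> n" and bij: "bij_betw F {0..<int n} {0..<int n}"
  shows "APN n F \<longleftrightarrow>
    (\<forall>u\<in>{0..<int n} - {0}. \<forall>v\<in>{0..<int n}. card (derivative_fibre n F u v) \<le> 2)"
proof -
  let ?C = "{card (derivative_fibre n F u v) | u v. u \<in> {0..<int n} - {0} \<and> v \<in> {0..<int n}}"
  have fin: "finite ?C"
  proof -
    have "?C = (\<lambda>(u, v). card (derivative_fibre n F u v)) ` (({0..<int n} - {0}) \<times> {0..<int n})"
      unfolding image_def by (simp del: atLeastLessThan_iff) blast
    thus ?thesis by simp
  qed
  define D where "D x = (F ((x + 1) mod int n) - F x) mod int n" for x
  have D_ne: "D x \<noteq> 0" if x: "x \<in> {0..<int n}" for x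
  proof
    assume "D x = 0"
    hence "F ((x + 1) mod int n) mod int n = F x mod int n"
      unfolding D_def by (metis mod_eq_dvd_iff dvd_eq_mod_eq_0)
    moreover have m: "(x + 1) mod int n \<in> {0..<int n}" using n by auto
    have "F ((x + 1) mod int n) \<in> {0..<int n}" "F x \<in> {0..<int n}"
      using bij m x by (auto dest: bij_betwE simp del: atLeastLessThan_iff)
    ultimately have "F ((x + 1) mod int n) = F x" by auto
    hence "(x + 1) mod int n = x"
      using bij m x unfolding bij_betw_def inj_on_def by blast
    thus False
      using x n by (cases "x + 1 = int n") auto
  qed
  have "\<not> inj_on D {0..<int n}"
  proof
    assume inj: "inj_on D {0..<int n}"
    have "D ` {0..<int n} \<subseteq> {1..<int n}"
    proof
      fix y assume "y \<in> D ` {0..<int n}"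
      then obtain x where x: "x \<in> {0..<int n}" "y = D x" by auto
      have "0 \<le> D x" "D x < int n" using n unfolding D_def by auto
      thus "y \<in> {1..<int n}" using D_ne[OF x(1)] x(2) by auto
    qed
    from card_inj_on_le[OF inj this] show False using n by simp
  qed
  then obtain x y where xy: "x \<in> {0..<int n}" "y \<in> {0..<int n}" "x \<noteq> y" "D x = D y"
    unfolding inj_on_def by blast
  have "{x, y} \<subseteq> derivative_fibre n F 1 (D x)"
    using xy unfolding derivative_fibre_def by (auto simp: D_def cong_def)
  hence "card {x, y} \<le> card (derivative_fibre n F 1 (D x))"
    by (intro card_mono) auto
  hence ge2: "2 \<le> card (derivative_fibre n F 1 (D x))" using xy by simp
  have memC: "card (derivative_fibre n F 1 (D x)) \<in> ?C"
  proof -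
    have "D x \<in> {0..<int n}" "(1::int) \<in> {0..<int n} - {0}" using n by (auto simp: D_def)
    thus ?thesis by blast
  qed
  have Max_iff: "Max C = 2 \<longleftrightarrow> (\<forall>k\<in>C. k \<le> 2)" if "finite C" "m \<in> C" "2 \<le> m" for C and m :: nat
  proof
    assume "Max C = 2"
    thus "\<forall>k\<in>C. k \<le> 2" using Max_ge[OF that(1)] by metis
  next
    assume le: "\<forall>k\<in>C. k \<le> 2"
    hence "2 \<in> C" using that(2,3) by (metis le_antisym)
    thus "Max C = 2" using that(1) le by (intro Max_eqI) simp_all
  qed
  have "APN n F \<longleftrightarrow> (\<forall>k\<in>?C. k \<le> 2)"
    unfolding APN_def differential_uniformity_def derivative_fibre_def[symmetric]
    by (rule Max_iff[OF fin memC ge2])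
  thus ?thesis by blast
qed

section \<open>Splitting off the parity\<close>

text \<open>
  A layer is named by the parity \<open>e\<close> of its elements: \<^term>\<open>False\<close> for the even layer,
  \<^term>\<open>True\<close> for the odd one.
\<close>

definition coef :: "'k::field \<Rightarrow> bool \<Rightarrow> 'k" where
  "coef a e = (if e then a else 1)"

definition par :: "bool \<Rightarrow> 'k::field \<Rightarrow> bool" where
  "par e x \<longleftrightarrow> (if x = 0 then e else quad_char x = 1)"

text \<open>
  Adding \<open>u\<close> to \<open>z\<close> changes \<open>X\<^sub>c(z)\<close> by \<open>u\<close> and this correction, where \<open>d\<close> is the parity of
  \<open>u\<close> and \<open>e\<close> that of \<open>z\<close>: leaving the even layer adds the summand \<open>c\<close>, leaving the odd layer
  removes it.
\<close>

definition shift :: "'k::field \<Rightarrow> bool \<Rightarrow> bool \<Rightarrow> 'k" where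
  "shift c d e = (if d then if e then - c else c else 0)"

text \<open>
  The points, in split coordinates, at which the shift with parity \<open>d\<close> and residue \<open>w\<close>
  produces the difference with parity \<open>s\<close> and residue \<open>b\<close>.
\<close>

definition solutions :: "'k::field \<Rightarrow> 'k \<Rightarrow> bool \<Rightarrow> 'k \<Rightarrow> bool \<Rightarrow> 'k \<Rightarrow> (bool \<times> 'k) set" where
  "solutions a c d w s b =
    {(e, x). coef a (e \<noteq> d) / (x + (w + shift c d e)) - coef a e / x = b \<and>
      (par (e \<noteq> d) (x + (w + shift c d e)) \<noteq> par e x) = s}"

definition model :: "'k::field \<Rightarrow> bool \<times> 'k \<Rightarrow> bool \<times> 'k" where
  "model a = (\<lambda>(e, x). (par e x, coef a e / x))"

definition coords :: "'k::field \<Rightarrow> int \<Rightarrow> bool \<times> 'k" where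
  "coords c z = (odd z, Xc c z)"

lemma Xc_eq: "Xc c z = of_int z + (if odd z then c else 0)"
  by (auto simp: Xc_def bitE_def odd_iff_mod_2_eq_one)

lemma quad_char_cases: "quad_char x = - 1 \<or> quad_char x = 0 \<or> quad_char x = 1"
  by (auto simp: quad_char_def)

lemma quad_char_eq_0_iff [simp]: "quad_char x = 0 \<longleftrightarrow> x = 0"
  by (auto simp: quad_char_def)

lemma quad_char_1 [simp]: "quad_char 1 = 1"
  unfolding quad_char_def by (metis one_power2 zero_neq_one)

lemma Rc_eq: "Rc c z = of_bool (par (odd z) (Xc c z))"
  unfolding Rc_def par_def rho_def bitE_def
  using quad_char_cases[of "Xc c z"] quad_char_eq_0_iff[of "Xc c z"]
  by (cases "Xc c z = 0") (auto simp: odd_iff_mod_2_eq_one quad_char_def)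

context
  fixes p :: nat and a c :: "'k::{field,finite}"
  assumes prime: "prime p" and p_gt: "p > 3" and card: "CARD('k) = p" and a_nz: "a \<noteq> 0"
begin

section \<open>The quadratic character of a prime field\<close>

lemma odd_p: "odd p"
  using prime_odd_nat[OF prime] p_gt by simp

lemma char_eq: "CHAR('k) = p"
  using CHAR_prime_card[OF prime card] .

lemma of_int_eq_0: "(of_int n :: 'k) = 0 \<longleftrightarrow> int p dvd n"
  using of_int_eq_0_iff_char_dvd[where ?'a = 'k] char_eq by simp

lemma of_int_eq: "(of_int m :: 'k) = of_int n \<longleftrightarrow> [m = n] (mod int p)"
  using of_int_eq_iff_cong_CHAR[where ?'a = 'k] char_eq by simp

lemma small_nz: "(2 :: 'k) \<noteq> 0" "(3 :: 'k) \<noteq> 0"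
  using of_int_eq_0[of 2] of_int_eq_0[of 3] p_gt by (auto dest: zdvd_imp_le)

text \<open>
  Euler's criterion, carried over from the integers. It yields the multiplicativity of the
  character, and also shows that \<open>x\<^bsup>p - 2\<^esup>\<close> is the inverse of \<open>x\<close>.
\<close>

lemma quad_char_euler: "(of_int (quad_char x) :: 'k) = x ^ ((p - 1) div 2)"
proof -
  have "x \<in> of_int ` {0..<int p}"
    using of_int_bij_betw_prime_field[OF prime card] unfolding bij_betw_def by simp
  then obtain n where n: "x = of_int n" by auto
  have "(\<exists>y. y ^ 2 = x) \<longleftrightarrow> QuadRes (int p) n"
  proof
    assume "\<exists>y. y ^ 2 = x"
    then obtain y where y: "y ^ 2 = x" by auto
    have "y \<in> of_int ` {0..<int p}"
      using of_int_bij_betw_prime_field[OF prime card] unfolding bij_betw_def by simp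
    then obtain m where "y = of_int m" by auto
    hence "(of_int (m ^ 2) :: 'k) = of_int n" using y n by simp
    thus "QuadRes (int p) n" unfolding of_int_eq QuadRes_def by auto
  next
    assume "QuadRes (int p) n"
    then obtain m where "[m ^ 2 = n] (mod int p)" unfolding QuadRes_def by auto
    hence "(of_int m :: 'k) ^ 2 = x" unfolding of_int_eq[symmetric] n by simp
    thus "\<exists>y. y ^ 2 = x" by auto
  qed
  hence "quad_char x = Legendre n (int p)"
    unfolding quad_char_def Legendre_def n by (auto simp: of_int_eq_0 cong_0_iff)
  moreover have "[Legendre n (int p) = n ^ ((p - 1) div 2)] (mod int p)"
    using euler_criterion[of p n] prime p_gt by simp
  ultimately show ?thesis
    unfolding of_int_eq[symmetric] n by simp
qed

text \<open>
  Lets an identity between values of the character be checked in the field.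
\<close>

lemma of_int_inj_small:
  assumes "(of_int m :: 'k) = of_int n" and "\<bar>m\<bar> \<le> 1" and "\<bar>n\<bar> \<le> 1"
  shows "m = n"
proof (rule ccontr)
  assume "m \<noteq> n"
  moreover have "int p dvd m - n" using assms(1) unfolding of_int_eq cong_iff_dvd_diff .
  ultimately have "int p \<le> \<bar>m - n\<bar>" using dvd_imp_le_int[of "m - n" "int p"] by simp
  thus False using assms(2,3) p_gt by linarith
qed

lemma quad_char_mult: "quad_char (x * y :: 'k) = quad_char x * quad_char y"
proof -
  have "(of_int (quad_char (x * y)) :: 'k) = of_int (quad_char x * quad_char y)"
    by (simp add: quad_char_euler power_mult_distrib)
  thus ?thesis
    by (rule of_int_inj_small)
      (use quad_char_cases[of x] quad_char_cases[of y] quad_char_cases[of "x * y"] in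
        \<open>elim disjE; simp del: quad_char_eq_0_iff\<close>)+
qed

lemma quad_char_square: "x \<noteq> 0 \<Longrightarrow> quad_char (x ^ 2 :: 'k) = 1"
  by (auto simp: quad_char_def)

lemma quad_char_nz: "x \<noteq> 0 \<Longrightarrow> quad_char (x :: 'k) = 1 \<or> quad_char x = - 1"
  by (auto simp: quad_char_def)

section \<open>The function in split coordinates\<close>

text \<open>
  The Chinese remainder theorem for \<open>2\<close> and \<open>p\<close>, as \<open>p\<close> is odd.
\<close>

lemma cong_2p_iff:
  "[x = y] (mod 2 * int p) \<longleftrightarrow> (odd x, of_int x :: 'k) = (odd y, of_int y)"
proof -
  have "[x = y] (mod 2) \<longleftrightarrow> odd x = odd y" unfolding cong_def by presburger
  moreover have "coprime 2 (int p)" using odd_p by simp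
  hence "[x = y] (mod 2 * int p) \<longleftrightarrow> [x = y] (mod 2) \<and> [x = y] (mod int p)"
    unfolding cong_iff_dvd_diff by (metis divides_mult dvd_mult_left dvd_mult_right)
  ultimately show ?thesis unfolding prod.inject of_int_eq by simp
qed

lemma bij_coords: "bij_betw (coords (d :: 'k)) {0..<2 * int p} UNIV"
proof -
  have "inj_on (coords d) {0..<2 * int p}"
  proof
    fix y z assume yz: "y \<in> {0..<2 * int p}" "z \<in> {0..<2 * int p}" "coords d y = coords d z"
    hence "[y = z] (mod 2 * int p)"
      unfolding cong_2p_iff by (auto simp: coords_def Xc_eq split: if_splits)
    thus "y = z" using yz by (simp add: cong_def)
  qed
  moreover from this have "coords d ` {0..<2 * int p} = UNIV"
    by (intro card_subset_eq)
      (auto simp: card_image card card_cartesian_product UNIV_Times_UNIV[symmetric]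
        simp del: UNIV_Times_UNIV)
  ultimately show ?thesis by (simp add: bij_betw_def)
qed

text \<open>
  The coefficients \<open>p\<close> and \<open>p + 1\<close> in the definition of the function are the two idempotents of
  the Chinese remainder theorem, so that \<open>R\<close> is the parity of the value and \<open>Y\<close> its residue.
\<close>

lemma Bac_model: "(odd (Bac p a c z), of_int (Bac p a c z)) = model a (coords c z)"
proof -
  let ?y = "residue p (Yac p a c z)"
  let ?B = "int p * Rc c z + (int p + 1) * ?y"
  have inv: "Xc c z ^ (p - 2) = inverse (Xc c z)"
  proof (cases "Xc c z = 0")
    case True thus ?thesis using p_gt by simp
  next
    case False
    have "(p - 1) div 2 + (p - 1) div 2 = Suc (p - 2)" using odd_p p_gt by presburger
    hence "Xc c z * Xc c z ^ (p - 2) = (of_int (quad_char (Xc c z)) :: 'k) ^ 2"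
      by (metis quad_char_euler power2_eq_square power_add power_Suc)
    also have "\<dots> = 1" using quad_char_nz[OF False] by auto
    finally show ?thesis using False by (metis inverse_unique)
  qed
  have "(of_int (Bac p a c z) :: 'k) = of_int ?B"
    unfolding of_int_eq Bac_def cong_def by (simp add: mod_mod_cancel)
  also have "\<dots> = of_int ?y"
    unfolding of_int_eq by (simp add: cong_iff_dvd_diff algebra_simps)
  also have "\<dots> = coef a (odd z) / Xc c z"
    unfolding residue(2)[OF prime card] Yac_def inv Aa_def bitE_def coef_def
    by (auto simp: odd_iff_mod_2_eq_one divide_simps)
  finally have 1: "(of_int (Bac p a c z) :: 'k) = coef a (odd z) / Xc c z" .
  have "odd (Bac p a c z) \<longleftrightarrow> odd ?B" unfolding Bac_def by (simp add: dvd_mod_iff)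
  also have "\<dots> \<longleftrightarrow> par (odd z) (Xc c z)" using odd_p by (simp add: Rc_eq)
  finally show ?thesis unfolding 1 model_def coords_def by simp
qed

lemma coords_add:
  "coords c ((z + u) mod (2 * int p)) =
    (odd z \<noteq> odd u, Xc c z + (of_int u + shift c (odd u) (odd z)))"
proof -
  have o: "odd ((z + u) mod (2 * int p)) \<longleftrightarrow> odd (z + u)" by (simp add: dvd_mod_iff)
  have "(of_int ((z + u) mod (2 * int p)) :: 'k) = of_int (z + u)"
    unfolding of_int_eq cong_def by (simp add: mod_mod_cancel)
  thus ?thesis unfolding coords_def Xc_eq o shift_def by auto
qed

lemma card_derivative_fibre:
  "card (derivative_fibre (2 * p) (Bac p a c) u v) =
    card (solutions a c (odd u) (of_int u) (odd v) (of_int v))"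
proof -
  let ?S = "solutions a c (odd u) (of_int u) (odd v) (of_int v)"
  let ?B = "Bac p a c"
  have diff: "[x - y = v] (mod 2 * int p) \<longleftrightarrow>
      (odd x \<noteq> odd y) = odd v \<and> (of_int x - of_int y :: 'k) = of_int v" for x y
    unfolding cong_2p_iff by auto
  have mem: "[?B ((z + u) mod (2 * int p)) - ?B z = v] (mod (2 * int p)) \<longleftrightarrow> coords c z \<in> ?S" for z
  proof -
    let ?e = "odd z \<noteq> odd u" and ?x = "Xc c z + (of_int u + shift c (odd u) (odd z))"
    have "odd (?B z) = par (odd z) (Xc c z)" "of_int (?B z) = coef a (odd z) / Xc c z"
      using Bac_model[of z] unfolding model_def coords_def prod.case prod.inject by auto
    moreover have "odd (?B ((z + u) mod (2 * int p))) = par ?e ?x"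
        "of_int (?B ((z + u) mod (2 * int p))) = coef a ?e / ?x"
      using Bac_model[of "(z + u) mod (2 * int p)"]
      unfolding coords_add model_def prod.case prod.inject by blast+
    ultimately show ?thesis
      unfolding diff coords_def solutions_def mem_Collect_eq prod.case by metis
  qed
  have "bij_betw (coords c) (derivative_fibre (2 * p) ?B u v) ?S"
    unfolding bij_betw_def
  proof
    show "inj_on (coords c) (derivative_fibre (2 * p) ?B u v)"
      using bij_betw_imp_inj_on[OF bij_coords]
      by (rule inj_on_subset) (auto simp: derivative_fibre_def)
    show "coords c ` derivative_fibre (2 * p) ?B u v = ?S"
      using bij_coords mem unfolding bij_betw_def derivative_fibre_def by fastforce
  qed
  thus ?thesis by (rule bij_betw_same_card)
qed

text \<open>
  Two points in different layers with the same residue \<open>1/x = a/y\<close> satisfy \<open>y = a x\<close>, so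
  their bits agree if and only if \<open>a\<close> is a square; points within one layer never collide.
\<close>

lemma bij_Bac_iff: "bij_betw (Bac p a c) {0..<2 * int p} {0..<2 * int p} \<longleftrightarrow> quad_char a = - 1"
proof -
  let ?B = "Bac p a c" and ?I = "{0..<2 * int p}"
  have range: "?B ` ?I \<subseteq> ?I" using p_gt by (auto simp: Bac_def)
  have eq: "?B y = ?B z \<longleftrightarrow> model a (coords c y) = model a (coords c z)" for y z
  proof -
    have "?B y = ?B z \<longleftrightarrow> [?B y = ?B z] (mod (2 * int p))" by (simp add: Bac_def cong_def)
    thus ?thesis unfolding cong_2p_iff Bac_model .
  qed
  have "bij_betw ?B ?I ?I \<longleftrightarrow> inj_on ?B ?I"
    using endo_inj_surj[OF _ range] by (auto simp: bij_betw_def)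
  also have "\<dots> \<longleftrightarrow> inj_on (model a) (coords c ` ?I)"
    using bij_coords unfolding bij_betw_def inj_on_def eq by blast
  also have "coords c ` ?I = UNIV" using bij_coords by (simp add: bij_betw_def)
  also have "inj (model a) \<longleftrightarrow> quad_char a = - 1"
  proof
    assume inj: "inj (model a)"
    have "quad_char a \<noteq> 1"
    proof
      assume "quad_char a = 1"
      \<comment> \<open>both have residue \<open>1\<close> and square argument\<close>
      hence "model a (False, 1) = model a (True, a)"
        using a_nz by (simp add: model_def coef_def par_def)
      thus False using inj by (auto dest: injD)
    qed
    thus "quad_char a = - 1" using quad_char_nz[OF a_nz] by auto
  next
    assume qa: "quad_char a = - 1"
    have cross: "model a (False, x) \<noteq> model a (True, y)" for x y
    proof
      assume "model a (False, x) = model a (True, y)"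
      hence h: "par False x = par True y" "1 / x = a / y"
        by (auto simp: model_def coef_def)
      show False
      proof (cases "x = 0 \<or> y = 0")
        case True
        thus False using h a_nz by (auto simp: par_def)
      next
        case False
        hence "y = a * x" using h by (simp add: field_simps)
        thus False using h False qa quad_char_nz[of x] by (auto simp: par_def quad_char_mult)
      qed
    qed
    show "inj (model a)"
    proof (rule injI, clarify)
      fix e x e' y assume h: "model a (e, x) = model a (e', y)"
      hence "e = e'" using cross[of x y] cross[of y x] by (cases e; cases e') auto
      thus "e = e' \<and> x = y" using h a_nz by (auto simp: model_def coef_def split: if_splits)
    qed
  qed
  finally show ?thesis .
qed


section \<open>Differences within a layer\<close>

lemma coef_nz: "coef a e \<noteq> 0"
  using a_nz by (simp add: coef_def)

lemma solutions_even:
  "(e, x) \<in> solutions a c False w s b \<longleftrightarrow>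
    coef a e / (x + w) - coef a e / x = b \<and> (par e (x + w) \<noteq> par e x) = s"
  by (simp add: solutions_def shift_def)

lemma ordinary_iff:
  fixes m x w b :: 'k
  assumes "x \<noteq> 0" "x + w \<noteq> 0"
  shows "m / (x + w) - m / x = b \<longleftrightarrow> b * (x * (x + w)) = - (m * w)"
proof -
  have "m / (x + w) - m / x = - (m * w) / (x * (x + w))"
    using assms by (simp add: field_simps)
  moreover have "\<dots> = b \<longleftrightarrow> - (m * w) = b * (x * (x + w))"
    using assms by (intro divide_eq_eq[THEN trans]) simp
  ultimately show ?thesis by metis
qed

text \<open>
  The bit changes precisely when \<open>x (x + w)\<close> is a nonsquare, and \<open>b\<^sup>2 x (x + w) = - m w b\<close>. The
  right-hand side of the equivalence is thus the same for all roots \<open>x\<close> and in both layers, up to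
  the factor \<open>m\<close>.
\<close>

lemma ordinary_parity:
  fixes m x w b :: 'k
  assumes "x \<noteq> 0" "x + w \<noteq> 0" "b \<noteq> 0" "b * (x * (x + w)) = - (m * w)"
  shows "(par e (x + w) \<noteq> par e x) \<longleftrightarrow> quad_char (- (m * w * b)) = - 1"
proof -
  have "b ^ 2 * (x * (x + w)) = - (m * w * b)"
    using assms(4) by (simp add: power2_eq_square mult.assoc mult.commute)
  hence "quad_char (- (m * w * b)) = quad_char x * quad_char (x + w)"
    by (metis quad_char_mult quad_char_square[OF assms(3)] mult_1)
  thus ?thesis
    using assms(1,2) quad_char_nz[OF assms(1)] quad_char_nz[OF assms(2)] by (auto simp: par_def)
qed

text \<open>
  If \<open>b w\<close> is the numerator of some layer, the conditions on the discriminants leave only the two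
  exceptional solutions, in that layer. Otherwise all solutions are ordinary; the change of the
  bit confines them to one layer, where they are roots of one quadratic equation.
\<close>

lemma card_solutions_even_le:
  assumes w: "w \<noteq> 0" and qa: "quad_char a = - 1" and q3: "quad_char (- 3 :: 'k) = - 1"
    and qa4: "quad_char (1 - 4 * a) = - 1" and q4a: "quad_char (1 - 4 / a) = - 1"
  shows "card (solutions a c False w s b) \<le> 2"
proof -
  let ?S = "solutions a c False w s b"
  have coef_inj: "e = e'" if "coef a e = coef a e'" for e e'
    using that qa by (auto simp: coef_def split: if_splits)
  have exceptional: "b * w = coef a e" if "(e, x) \<in> ?S" "x = 0 \<or> x + w = 0" for e x
    using that w by (auto simp: solutions_even eq_neg_iff_add_eq_0[symmetric])
  have ordinary: "b * (x * (x + w)) = - (coef a e * w)"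
    if "(e, x) \<in> ?S" "x \<noteq> 0" "x + w \<noteq> 0" for e x
    using that by (simp add: solutions_even ordinary_iff)
  have bound: ?thesis if "?S \<subseteq> {X, Y}" for X Y
    using card_mono[OF _ that] by (simp add: card_insert_if split: if_splits)
  show ?thesis
  proof (cases "\<exists>e. b * w = coef a e")
    case True
    then obtain e0 where e0: "b * w = coef a e0" by auto
    have "(e, x) \<in> {(e0, 0), (e0, - w)}" if S: "(e, x) \<in> ?S" for e x
    proof (cases "x = 0 \<or> x + w = 0")
      case True
      thus ?thesis using exceptional[OF S True] e0 coef_inj by (auto simp: eq_neg_iff_add_eq_0)
    next
      case False
      have "b \<noteq> 0" using e0 coef_nz[of e0] by auto
      have "coef a e0 * (x * (x + w)) = w * (b * (x * (x + w)))"
        unfolding e0[symmetric] by (simp only: ac_simps)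
      also have "\<dots> = - (coef a e * w ^ 2)"
        using ordinary[OF S] False by (simp add: power2_eq_square)
      finally have "coef a e0 * (x * (x + w)) = - (coef a e * w ^ 2)" .
      moreover have "coef a e0 * (2 * x + w) ^ 2 =
          4 * (coef a e0 * (x * (x + w))) + coef a e0 * w ^ 2"
        by (simp add: algebra_simps power2_eq_square)
      ultimately have "coef a e0 * (2 * x + w) ^ 2 = (coef a e0 - 4 * coef a e) * w ^ 2"
        by (simp add: algebra_simps)
      moreover have "coef a e0 - 4 * coef a e = coef a e0 * (1 - 4 * coef a e / coef a e0)"
        using coef_nz[of e0] by (simp add: field_simps)
      ultimately have "(2 * x + w) ^ 2 = (1 - 4 * coef a e / coef a e0) * w ^ 2"
        using coef_nz[of e0] by simp
      \<comment> \<open>complete the square: the discriminant would be a square\<close>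
      hence "((2 * x + w) / w) ^ 2 = 1 - 4 * coef a e / coef a e0"
        using w by (simp add: power_divide)
      moreover have "quad_char (1 - 4 * coef a e / coef a e0) = - 1"
        using qa4 q4a q3 a_nz by (cases e; cases e0) (simp_all add: coef_def)
      ultimately show ?thesis by (metis quad_char_def zero_neq_neg_one one_neq_neg_one)
    qed
    hence "?S \<subseteq> {(e0, 0), (e0, - w)}" by auto
    thus ?thesis by (rule bound)
  next
    case False
    show ?thesis
    proof (cases "?S = {}")
      case nonempty: False
      then obtain e x where S: "(e, x) \<in> ?S" by auto
      have no_exc: "y \<noteq> 0" "y + w \<noteq> 0" if "(e', y) \<in> ?S" for e' y
        using exceptional[OF that] False by auto
      note ord = ordinary[OF _ no_exc(1) no_exc(2)]
      have b: "b \<noteq> 0" using ord[OF S S S] w coef_nz[of e] by auto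
      have "(e', y) \<in> {(e, x), (e, - w - x)}" if S': "(e', y) \<in> ?S" for e' y
      proof -
        have split: "quad_char (- (coef a f * w * b)) = quad_char (coef a f) * quad_char (- (w * b))"
          for f
          unfolding quad_char_mult[symmetric] by (simp add: mult.assoc)
        have "quad_char (- (coef a e' * w * b)) = - 1 \<longleftrightarrow> quad_char (- (coef a e * w * b)) = - 1"
          using ordinary_parity[OF no_exc[OF S'] b ord[OF S' S' S']]
            ordinary_parity[OF no_exc[OF S] b ord[OF S S S]] S S' by (auto simp: solutions_even)
        moreover have "quad_char (- (w * b)) = 1 \<or> quad_char (- (w * b)) = - 1"
          using w b by (intro quad_char_nz) simp
        ultimately have e: "e' = e"
          using qa unfolding split by (cases e; cases e') (auto simp: coef_def)
        have "b * (y * (y + w)) = b * (x * (x + w))"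
          using ord[OF S S S] ord[OF S' S' S'] e by simp
        hence "y * (y + w) = x * (x + w)" using b by simp
        hence "(y - x) * (y - (- w - x)) = 0" by (simp add: algebra_simps)
        hence "y = x \<or> y = - w - x" unfolding mult_eq_0_iff by simp
        thus ?thesis using e by auto
      qed
      hence "?S \<subseteq> {(e, x), (e, - w - x)}" by auto
      thus ?thesis by (rule bound)
    qed simp
  qed
qed

text \<open>
  Take \<open>b\<close> so that \<open>x = 0\<close> is an exceptional solution in layer \<open>e\<close>. The hypothesis provides two
  ordinary solutions in layer \<open>e'\<close>, and their change of the bit is determined by the two
  numerators alone. That of \<open>x = 0\<close> depends on whether \<open>w\<close> is a square, so \<open>w\<close> can be
  chosen to make the three agree.
\<close>

lemma three_solutions:
  assumes qa: "quad_char a = - 1" and q: "quad_char (1 - 4 * coef a e' / coef a e) = 1"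
  shows "\<exists>w s b. w \<noteq> 0 \<and> \<not> card (solutions a c False w s b) \<le> 2"
proof -
  let ?m = "coef a e" and ?m' = "coef a e'"
  obtain r where r: "r ^ 2 = 1 - 4 * ?m' / ?m" "r \<noteq> 0"
    using q unfolding quad_char_def by (metis power_zero_numeral zero_neq_one one_neq_neg_one)
  define s where "s \<longleftrightarrow> quad_char (- (?m' * ?m)) = - 1"
  \<comment> \<open>\<open>1\<close> and \<open>a\<close> serve as a square and a nonsquare\<close>
  define w where "w = (if e \<noteq> s then 1 else a)"
  define b where "b = ?m / w"
  have w: "w \<noteq> 0" "(quad_char w = 1) = (e \<noteq> s)" using a_nz qa by (auto simp: w_def)
  have b: "b \<noteq> 0" using w(1) coef_nz[of e] by (simp add: b_def)
  have four: "(4 :: 'k) \<noteq> 0"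
    using small_nz(1) by (metis mult_2 mult_eq_0_iff numeral_Bit0)
  \<comment> \<open>the roots of \<open>x (x + w) = - w\<^sup>2 m'/m\<close>, for either square root \<open>t\<close> of \<open>1 - 4 m'/m\<close>\<close>
  have root: "(e', w * (t - 1) / 2) \<in> solutions a c False w s b" (is "(_, ?x) \<in> _")
    if t: "t ^ 2 = 1 - 4 * ?m' / ?m" for t
  proof -
    have "?x * (?x + w) = w ^ 2 * (t ^ 2 - 1) / 4"
      using small_nz(1) four by (simp add: field_simps power2_eq_square)
    also have "\<dots> = - (w ^ 2 * (?m' / ?m))" unfolding t using four by simp
    finally have x: "?x * (?x + w) = - (w ^ 2 * (?m' / ?m))" .
    hence eq: "b * (?x * (?x + w)) = - (?m' * w)"
      unfolding b_def x using w(1) coef_nz[of e] by (simp add: power2_eq_square)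
    have "?x * (?x + w) \<noteq> 0" unfolding x using w(1) coef_nz[of e] coef_nz[of e'] by simp
    hence nz: "?x \<noteq> 0" "?x + w \<noteq> 0" by (metis mult_eq_0_iff)+
    have "?m' * w * b = ?m' * ?m" using w(1) by (simp add: b_def)
    hence "(par e' (?x + w) \<noteq> par e' ?x) = s"
      using ordinary_parity[OF nz b eq, of e'] unfolding s_def by metis
    thus ?thesis unfolding solutions_even ordinary_iff[OF nz] using eq by blast
  qed
  have "(e, 0) \<in> solutions a c False w s b"
    unfolding solutions_even using w by (auto simp: b_def par_def)
  hence "{(e, 0), (e', w * (r - 1) / 2), (e', w * (- r - 1) / 2)} \<subseteq> solutions a c False w s b"
    using root[of r] root[of "- r"] r by simp
  hence "card {(e, 0), (e', w * (r - 1) / 2), (e', w * (- r - 1) / 2)}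
      \<le> card (solutions a c False w s b)"
    by (intro card_mono) auto
  moreover have "r \<noteq> - r"
    using r(2) small_nz(1) by (metis mult_2 mult_eq_0_iff eq_neg_iff_add_eq_0)
  \<comment> \<open>for \<open>e = e'\<close>, the ordinary solutions must also differ from \<open>x = 0\<close>\<close>
  moreover have "r ^ 2 \<noteq> 1" unfolding r(1) using four coef_nz[of e] coef_nz[of e'] by simp
  hence "r \<noteq> 1" "- r \<noteq> 1" by (metis one_power2, metis one_power2 power2_minus)
  ultimately have "3 \<le> card (solutions a c False w s b)"
    using w(1) small_nz(1) by (simp add: card_insert_if)
  thus ?thesis using w(1) by (intro exI[of _ w] exI[of _ s] exI[of _ b]) simp
qed

section \<open>Differences across the layers\<close>

text \<open>
  For \<open>k = 0\<close> the difference is \<open>(a - 1)/x\<close>, which is injective. For \<open>k \<noteq> 0\<close> the exceptional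
  points \<open>x = 0\<close> and \<open>x = - k\<close> occur for \<open>b = a/k\<close> and \<open>b = 1/k\<close>, where the quadratic equation
  has the discriminants \<open>1 - 4 a\<close> and \<open>1 - 4/a\<close>, up to squares, hence no root; these two values
  of \<open>b\<close> differ because the nonsquare \<open>a\<close> is not \<open>1\<close>. Two distinct
  ordinary solutions \<open>x\<close>, \<open>y\<close> satisfy \<open>b x y = k\<close> and \<open>b (x + k) (y + k) = a k\<close>; as \<open>a\<close> is a
  nonsquare, the bit changes at one of them only.
\<close>

lemma cross_unique:
  fixes x y k b :: 'k
  assumes qa: "quad_char a = - 1" and qa4: "quad_char (1 - 4 * a) = - 1"
    and q4a: "quad_char (1 - 4 / a) = - 1"
    and x: "a / (x + k) - 1 / x = b" and y: "a / (y + k) - 1 / y = b"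
    and parity: "(par True (x + k) \<noteq> par False x) = (par True (y + k) \<noteq> par False y)"
  shows "x = y"
proof (cases "k = 0")
  case True
  have "a \<noteq> 1" using qa by auto
  moreover have "(a - 1) / x = (a - 1) / y" using x y True by (simp add: diff_divide_distrib)
  ultimately show ?thesis by simp
next
  case k: False
  have a1: "a \<noteq> 1" using qa by auto
  have nonsquare: "t ^ 2 \<noteq> z" if "quad_char z = - 1" for t z :: 'k
    using that by (auto simp: quad_char_def split: if_splits)
  have zero: "v = 0" if "a / (v + k) - 1 / v = a / k" for v
  proof (rule ccontr)
    assume v: "v \<noteq> 0"
    show False
    proof (cases "v + k = 0")
      case True
      hence "v = - k" by (simp add: eq_neg_iff_add_eq_0)
      thus False using that k a1 by simp
    next
      case False
      have "k * (a * v - (v + k)) = a * (v * (v + k))"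
        using that v k False by (simp add: field_simps)
      hence "a * v ^ 2 + k * v + k ^ 2 = 0"
        by (simp add: algebra_simps power2_eq_square)
      moreover have "(2 * a * v + k) ^ 2 - (1 - 4 * a) * k ^ 2 = 4 * a * (a * v ^ 2 + k * v + k ^ 2)"
        by (simp add: algebra_simps power2_eq_square)
      ultimately have "(2 * a * v + k) ^ 2 = (1 - 4 * a) * k ^ 2" by simp
      hence "((2 * a * v + k) / k) ^ 2 = 1 - 4 * a" using k by (simp add: power_divide)
      thus False using nonsquare[OF qa4] by blast
    qed
  qed
  have minus: "v + k = 0" if "a / (v + k) - 1 / v = 1 / k" for v
  proof (rule ccontr)
    assume vk: "v + k \<noteq> 0"
    show False
    proof (cases "v = 0")
      case True
      thus False using that k a1 by simp
    next
      case False
      have "k * (a * v - (v + k)) = v * (v + k)"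
        using that vk k False by (simp add: field_simps)
      hence "v ^ 2 + (2 - a) * k * v + k ^ 2 = 0"
        by (simp add: algebra_simps power2_eq_square)
      moreover have "(2 * v + (2 - a) * k) ^ 2 - (a ^ 2 - 4 * a) * k ^ 2 =
          4 * (v ^ 2 + (2 - a) * k * v + k ^ 2)"
        by (simp add: algebra_simps power2_eq_square)
      ultimately have "(2 * v + (2 - a) * k) ^ 2 = (a ^ 2 - 4 * a) * k ^ 2" by simp
      moreover have "a ^ 2 - 4 * a = (1 - 4 / a) * a ^ 2"
        using a_nz by (simp add: field_simps power2_eq_square)
      ultimately have "((2 * v + (2 - a) * k) / (k * a)) ^ 2 = 1 - 4 / a"
        using k a_nz by (simp add: power_divide power_mult_distrib)
      thus False using nonsquare[OF q4a] by blast
    qed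
  qed
  consider "x = 0" | "y = 0" | "x + k = 0" | "y + k = 0"
    | "x \<noteq> 0" "y \<noteq> 0" "x + k \<noteq> 0" "y + k \<noteq> 0" by blast
  thus ?thesis
  proof cases
    case 1 thus ?thesis using zero[of y] x y by simp
  next
    case 2 thus ?thesis using zero[of x] x y by simp
  next
    case 3
    hence xk: "x = - k" by (simp add: eq_neg_iff_add_eq_0)
    have "b = 1 / k" using x unfolding xk by simp
    hence "y + k = 0" using minus y by blast
    thus ?thesis using xk by (metis eq_neg_iff_add_eq_0)
  next
    case 4
    hence yk: "y = - k" by (simp add: eq_neg_iff_add_eq_0)
    have "b = 1 / k" using y unfolding yk by simp
    hence "x + k = 0" using minus x by blast
    thus ?thesis using yk by (metis eq_neg_iff_add_eq_0)
  next
    case 5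
    show ?thesis
    proof (rule ccontr)
      assume ne: "x \<noteq> y"
      \<comment> \<open>Vieta's formulas, without dividing by \<open>b\<close>\<close>
      have ex: "a * x - (x + k) = b * (x * (x + k))" using x 5 by (simp add: field_simps)
      have ey: "a * y - (y + k) = b * (y * (y + k))" using y 5 by (simp add: field_simps)
      have "(x - y) * (a - 1) = (a * x - (x + k)) - (a * y - (y + k))"
        by (simp add: algebra_simps)
      also have "\<dots> = (x - y) * (b * (x + y + k))"
        unfolding ex ey by (simp add: algebra_simps)
      finally have sum: "a - 1 = b * (x + y + k)" using ne by simp
      have "k = x * (a - 1) - (a * x - (x + k))" by (simp add: algebra_simps)
      also have "\<dots> = b * (x * y)" unfolding ex sum by (simp add: algebra_simps)
      finally have prod: "b * (x * y) = k" ..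
      have "b * ((x + k) * (y + k)) = b * (x * y) + k * (b * (x + y + k))"
        by (simp add: algebra_simps)
      also have "\<dots> = a * k" unfolding prod sum[symmetric] by (simp add: algebra_simps)
      finally have "(b * (x * y)) * (b * ((x + k) * (y + k))) = k * (a * k)" unfolding prod by simp
      hence "b ^ 2 * ((x * y) * ((x + k) * (y + k))) = a * k ^ 2"
        by (simp only: power2_eq_square ac_simps)
      moreover have "b \<noteq> 0" using prod k by auto
      ultimately have "quad_char ((x * y) * ((x + k) * (y + k))) = quad_char a"
        by (metis quad_char_mult quad_char_square k mult_1 mult_1_right)
      hence "quad_char x * quad_char y * (quad_char (x + k) * quad_char (y + k)) = - 1"
        unfolding qa quad_char_mult .
      thus False
        using parity 5 quad_char_nz[OF 5(1)] quad_char_nz[OF 5(2)] quad_char_nz[OF 5(3)]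
          quad_char_nz[OF 5(4)] by (auto simp: par_def)
    qed
  qed
qed

text \<open>
  A solution that leaves the odd layer for \<open>y\<close> is, read backwards, one that leaves the even layer
  from \<open>y\<close>, with the opposite difference. Thus \<open>cross_unique\<close> applies to both layers, and a solution
  is determined by its layer.
\<close>

lemma card_solutions_odd_le:
  assumes qa: "quad_char a = - 1" and qa4: "quad_char (1 - 4 * a) = - 1"
    and q4a: "quad_char (1 - 4 / a) = - 1"
  shows "card (solutions a c True w s b) \<le> 2"
proof -
  let ?S = "solutions a c True w s b"
  note unique = cross_unique[OF qa qa4 q4a]
  have "x = y" if "(e, x) \<in> ?S" "(e, y) \<in> ?S" for e x y
  proof (cases e)
    case False
    thus ?thesis using that
      by (intro unique[of x "w + c" b y]) (auto simp: solutions_def shift_def coef_def)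
  next
    case True
    let ?k = "w - c"
    have h: "1 / (x + ?k) - a / x = b" "1 / (y + ?k) - a / y = b"
        "(par False (x + ?k) \<noteq> par True x) = (par False (y + ?k) \<noteq> par True y)"
      using that True by (simp_all add: solutions_def shift_def coef_def)
    \<comment> \<open>the reversed step starts at \<open>x + k\<close> in the even layer and shifts by \<open>- k\<close>\<close>
    have "x + ?k = y + ?k"
    proof (rule unique)
      show "a / (x + ?k + - ?k) - 1 / (x + ?k) = - b" unfolding h(1)[symmetric] by simp
      show "a / (y + ?k + - ?k) - 1 / (y + ?k) = - b" unfolding h(2)[symmetric] by simp
      show "(par True (x + ?k + - ?k) \<noteq> par False (x + ?k)) =
          (par True (y + ?k + - ?k) \<noteq> par False (y + ?k))" using h(3) by auto
    qed
    thus ?thesis by simp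
  qed
  hence "inj_on fst ?S" by (auto simp: inj_on_def)
  hence "card ?S \<le> card (UNIV :: bool set)" by (rule card_inj_on_le) auto
  thus ?thesis by simp
qed

section \<open>The criterion\<close>

lemma APN_permutation_Bac_iff:
  "APN_permutation (2 * p) (Bac p a c) \<longleftrightarrow>
    quad_char a = - 1 \<and> quad_char (- 3 :: 'k) = - 1 \<and>
    quad_char (1 - 4 * a) = - 1 \<and> quad_char (1 - 4 / a) = - 1"
proof (cases "quad_char a = - 1")
  case False
  thus ?thesis using bij_Bac_iff by (simp add: APN_permutation_def)
next
  case qa: True
  let ?I = "{0..<2 * int p}"
  have two_p: "int (2 * p) = 2 * int p" by simp
  have "APN_permutation (2 * p) (Bac p a c) \<longleftrightarrow>
      (\<forall>u\<in>?I - {0}. \<forall>v\<in>?I. card (solutions a c (odd u) (of_int u) (odd v) (of_int v)) \<le> 2)"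
    using permutation_APN_iff[of "2 * p" "Bac p a c"] bij_Bac_iff qa p_gt
    unfolding APN_permutation_def card_derivative_fibre two_p by simp
  also have "\<dots> \<longleftrightarrow> (\<forall>d w s (b :: 'k). (d, w) \<noteq> (False, 0) \<longrightarrow> card (solutions a c d w s b) \<le> 2)"
    (is "?L \<longleftrightarrow> ?R")
  proof
    assume L: ?L
    have ex: "\<exists>u\<in>?I. odd u = d \<and> of_int u = w" for d and w :: 'k
    proof -
      have "(d, w) \<in> coords 0 ` ?I" using bij_coords[of 0] by (simp add: bij_betw_def)
      thus ?thesis by (auto simp: coords_def Xc_eq split: if_splits)
    qed
    show ?R
    proof (intro allI impI)
      fix d s and w b :: 'k assume ne: "(d, w) \<noteq> (False, 0)"
      obtain u where u: "u \<in> ?I" "odd u = d" "of_int u = w" using ex by blast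
      obtain v where v: "v \<in> ?I" "odd v = s" "of_int v = b" using ex by blast
      have "u \<noteq> 0" using u ne by auto
      thus "card (solutions a c d w s b) \<le> 2" using L u v by blast
    qed
  next
    assume R: ?R
    have "(odd u, of_int u :: 'k) \<noteq> (False, 0)" if "u \<in> ?I - {0}" for u
    proof
      assume "(odd u, of_int u :: 'k) = (False, 0)"
      hence "[u = 0] (mod 2 * int p)" unfolding cong_2p_iff by simp
      thus False using that by (auto simp: cong_def)
    qed
    thus ?L using R by blast
  qed
  also have "\<dots> \<longleftrightarrow> quad_char (- 3 :: 'k) = - 1 \<and>
      quad_char (1 - 4 * a) = - 1 \<and> quad_char (1 - 4 / a) = - 1" (is "?R \<longleftrightarrow> ?Q")
  proof
    assume R: ?R
    have ne1: "quad_char (1 - 4 * coef a e' / coef a e) \<noteq> 1" for e e'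
      using three_solutions[OF qa, of e' e] R by blast
    have four: "(4 :: 'k) = 2 ^ 2" by simp
    have "a \<noteq> 4" using qa quad_char_square[OF small_nz(1)] unfolding four by auto
    moreover have "1 - 4 * a \<noteq> 0"
    proof
      assume "1 - 4 * a = 0"
      hence "quad_char (2 ^ 2 * a) = 1" by simp
      thus False unfolding quad_char_mult quad_char_square[OF small_nz(1)] using qa by simp
    qed
    moreover have "(- 3 :: 'k) \<noteq> 0" using small_nz(2) by simp
    ultimately show ?Q
      using ne1[of False False] ne1[of True False] ne1[of False True] a_nz
        quad_char_nz[of "- 3"] quad_char_nz[of "1 - 4 * a"] quad_char_nz[of "1 - 4 / a"]
      by (simp add: coef_def)
  next
    assume Q: ?Q
    show ?R
    proof (intro allI impI)
      fix d s and w b :: 'k assume ne: "(d, w) \<noteq> (False, 0)"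
      show "card (solutions a c d w s b) \<le> 2"
        using Q qa ne card_solutions_odd_le card_solutions_even_le by (cases d) auto
    qed
  qed
  finally show ?thesis using qa by simp
qed

end

theorem theorem6:
  fixes p :: nat and a c :: "'k::{field,finite}"
  assumes "prime p" and "p \<ge> 11" and "CARD('k) = p" and "a \<noteq> 0"
  shows "(APN_permutation (2 * p) (Bac p a c) \<longleftrightarrow>
            quad_char a = - 1 \<and> quad_char (- 3 :: 'k) = - 1 \<and>
            quad_char (1 - 4 * a) = - 1 \<and> quad_char (1 - 4 / a) = - 1) \<and>
         (\<forall>c'. APN_permutation (2 * p) (Bac p a c') \<longleftrightarrow> APN_permutation (2 * p) (Bac p a c))"
proof -
  have "p > 3" using assms(2) by simp
  note iff = APN_permutation_Bac_iff[OF assms(1) this assms(3,4)]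
  show ?thesis by (simp add: iff)
qed

end
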